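(* Let $f$ and $f'$ be integer binary quadratic forms on $\mathbb{Z}^2$ with $d(f')\neq 0$. Then there exist a binary quadratic form $F$ on $\mathbb{Z}^2$ and a composition law $\circ$ such that $F$ is composed of $f$ and $f'$ by means of $\circ$ if and only if the ratio $d(f)/d(f')$ is the square of some rational number.
   Context: A binary quadratic form is a function $f(x,y)=ax^2+bxy+cy^2$ with real coefficients, written $(a,b,c)$ and regarded as a function on $\mathbb{Z}^2$; it is integer if $a,b,c\in\mathbb{Z}$. Its discriminant is $d(f)=b^2-4ac$. Composition: let $\circ:\mathbb{Z}^2\times\mathbb{Z}^2\to\mathbb{Z}^2$ be a $\mathbb{Z}$-bilinear map, and let $f,f',F$ be binary quadratic forms on $\mathbb{Z}^2$ such that $F(\mathbf{x}\circ\mathbf{x}')=f(\mathbf{x})f'(\mathbf{x}')$ for all $\mathbf{x},\mathbf{x}'\in\mathbb{Z}^2$. Suppose additionally that the vectors $\mathbf{x}\circ\mathbf{x}'$ (for $\mathbf{x},\mathbf{x}'\in\mathbb{Z}^2$) span $\mathbb{Z}^2$ as an abelian group. Then $\circ$ is called a composition law, and $F$ is said to be composed of $f$ and $f'$ by means of $\circ$. *)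

theory Defs
  imports Complex_Main "HOL-Library.Product_Plus"
begin

text \<open>
  A binary quadratic form is represented by its coefficient triple; \<open>form_value\<close> is the
  associated function on \<open>\<int>\<^sup>2\<close>. The two views agree, since the function determines the triple
  (lemma \<open>form_value_inject\<close>), so the discriminant depends only on the function.
\<close>

datatype quadratic_form = Form (coeff_a: real) (coeff_b: real) (coeff_c: real)

fun form_value :: "quadratic_form \<Rightarrow> int \<times> int \<Rightarrow> real" where
  "form_value (Form a b c) (x, y) =
     a * (of_int x)\<^sup>2 + b * of_int x * of_int y + c * (of_int y)\<^sup>2"

lemma form_value_inject: "form_value f = form_value g \<longleftrightarrow> f = g"
proof
  assume eq: "form_value f = form_value g"
  obtain a b c where f: "f = Form a b c" by (cases f)
  obtain a' b' c' where g: "g = Form a' b' c'" by (cases g)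
  have "form_value f (1, 0) = form_value g (1, 0)" "form_value f (0, 1) = form_value g (0, 1)"
    "form_value f (1, 1) = form_value g (1, 1)"
    by (simp_all only: eq)
  then show "f = g" by (simp add: f g)
qed simp

definition integer_form :: "quadratic_form \<Rightarrow> bool" where
  "integer_form f \<longleftrightarrow> coeff_a f \<in> \<int> \<and> coeff_b f \<in> \<int> \<and> coeff_c f \<in> \<int>"

definition discriminant :: "quadratic_form \<Rightarrow> real" where
  "discriminant f = (coeff_b f)\<^sup>2 - 4 * coeff_a f * coeff_c f"

definition zscale :: "int \<Rightarrow> int \<times> int \<Rightarrow> int \<times> int" where
  "zscale n v = (n * fst v, n * snd v)"

interpretation Z2: module zscale
  by unfold_locales (simp_all add: zscale_def algebra_simps)

definition Z_bilinear :: "(int \<times> int \<Rightarrow> int \<times> int \<Rightarrow> int \<times> int) \<Rightarrow> bool" where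
  "Z_bilinear m \<longleftrightarrow>
     (\<forall>x. module_hom zscale zscale (\<lambda>x'. m x x')) \<and>
     (\<forall>x'. module_hom zscale zscale (\<lambda>x. m x x'))"

text \<open>
  \<open>composed_of F f f' m\<close>: the map \<open>m\<close> is a composition law, and \<open>F\<close> is composed of \<open>f\<close> and \<open>f'\<close> by
  means of \<open>m\<close>. The generated subgroup is expressed as the \<open>\<int>\<close>-linear span.
\<close>

definition composed_of ::
  "quadratic_form \<Rightarrow> quadratic_form \<Rightarrow> quadratic_form \<Rightarrow>
    (int \<times> int \<Rightarrow> int \<times> int \<Rightarrow> int \<times> int) \<Rightarrow> bool" where
  "composed_of F f f' m \<longleftrightarrow>
     Z_bilinear m \<and>
     (\<forall>x x'. form_value F (m x x') = form_value f x * form_value f' x') \<and>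
     Z2.span {m x x' | x x'. True} = UNIV"

end

theory Submission
  imports Defs
begin

text \<open>
  If \<open>F\<close> is composed of \<open>f\<close> and \<open>f'\<close>, then fixing one argument of the composition gives a linear
  substitution in \<open>F\<close>, and comparing discriminants yields
  \<open>d(F) (det L\<^sub>x)\<^sup>2 = f(x)\<^sup>2 d(f')\<close> and \<open>d(F) (det R\<^sub>x')\<^sup>2 = f'(x')\<^sup>2 d(f)\<close>; divide.

  Conversely, completing the square at a vector \<open>w\<close> with \<open>f(w) \<noteq> 0\<close> writes \<open>4 f(w) f\<close> as
  \<open>U\<^sup>2 - d(f) V\<^sup>2\<close> with integer linear forms \<open>U\<close>, \<open>V\<close>, and likewise for \<open>f'\<close>. As \<open>d(f)\<close> and \<open>d(f')\<close>
  differ by a rational square, both are norm forms of the same algebra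
  \<open>\<rat>[t]/(t\<^sup>2 - d(f'))\<close>, whose multiplication is an integer bilinear map after clearing
  denominators. Its values span a lattice of rank 2, and rewriting in a basis of this lattice makes
  them span \<open>\<int>\<^sup>2\<close>.
\<close>

section \<open>Linear maps on the lattice of integer pairs\<close>

lemma zscale_Pair: "zscale r (x, y) = (r * x, r * y)"
  by (simp add: zscale_def)

lemma module_hom_zscale_iff:
  "module_hom zscale zscale h \<longleftrightarrow>
     (\<forall>x y. h (x + y) = h x + h y) \<and> (\<forall>r x. h (zscale r x) = zscale r (h x))"
  by (simp add: module_hom_iff Z2.module_axioms)

lemma module_hom_zscale_expand:
  assumes "module_hom zscale zscale h"
  shows "h (s, t) = (s * fst (h (1, 0)) + t * fst (h (0, 1)), s * snd (h (1, 0)) + t * snd (h (0, 1)))"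
proof -
  have "(s, t) = zscale s (1, 0) + zscale t (0, 1)"
    by (simp add: zscale_def)
  then have "h (s, t) = zscale s (h (1, 0)) + zscale t (h (0, 1))"
    using assms by (metis module_hom_zscale_iff)
  then show ?thesis
    by (simp add: zscale_def plus_prod_def)
qed

section \<open>Values of forms, and discriminants under linear substitution\<close>

lemma form_value_nonzero_exists:
  assumes "discriminant f \<noteq> 0 \<or> f \<noteq> Form 0 0 0"
  obtains w where "form_value f w \<noteq> 0"
proof -
  have "f \<noteq> Form 0 0 0"
    using assms by (auto simp: discriminant_def)
  moreover have "form_value (Form 0 0 0) = (\<lambda>_. 0)"
    by (auto simp: fun_eq_iff)
  ultimately have "form_value f \<noteq> (\<lambda>_. 0)"
    by (metis form_value_inject)
  then show ?thesis
    using that by (auto simp: fun_eq_iff)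
qed

lemma integer_formE:
  assumes "integer_form f"
  obtains a b c :: int where "f = Form (of_int a) (of_int b) (of_int c)"
  using assms by (cases f) (auto simp: integer_form_def elim!: Ints_cases)

lemma integer_form_value_Ints:
  assumes "integer_form f"
  shows "form_value f x \<in> \<int>"
  using assms by (cases f; cases x) (auto simp: integer_form_def)

text \<open>The substitution matrix is real while \<open>form_value\<close> accepts only integer
  points, so values are compared only where the image point is integral.\<close>

lemma form_value_substitution:
  fixes p q r s :: real
  obtains G where
    "discriminant G = discriminant F * (p * s - q * r)\<^sup>2"
    "\<And>x y x' y'. of_int x' = p * of_int x + q * of_int y \<Longrightarrow>
       of_int y' = r * of_int x + s * of_int y \<Longrightarrow> form_value G (x, y) = form_value F (x', y')"
proof -
  obtain a b c where F: "F = Form a b c" by (cases F)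
  show thesis
    by (rule that[of "Form (a * p\<^sup>2 + b * p * r + c * r\<^sup>2)
        (2 * a * p * q + b * (p * s + q * r) + 2 * c * r * s) (a * q\<^sup>2 + b * q * s + c * s\<^sup>2)"])
      (simp_all add: F discriminant_def power2_eq_square algebra_simps)
qed

text \<open>Both sides are the discriminant of the same form: substitution multiplies it by the
  squared determinant, scaling by \<open>k\<close> multiplies it by \<open>k\<^sup>2\<close>. In
  use, \<open>h\<close> is a composition with one argument fixed and \<open>k\<close> the value at
  that argument.\<close>

lemma discriminant_substitution:
  assumes "module_hom zscale zscale h"
    and val: "\<And>x. form_value F (h x) = k * form_value g x"
  shows "discriminant F *
      (of_int (fst (h (1, 0)) * snd (h (0, 1)) - fst (h (0, 1)) * snd (h (1, 0))))\<^sup>2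
    = k\<^sup>2 * discriminant g"
proof -
  obtain G where d: "discriminant G = discriminant F *
      (real_of_int (fst (h (1, 0))) * of_int (snd (h (0, 1)))
        - of_int (fst (h (0, 1))) * of_int (snd (h (1, 0))))\<^sup>2"
    and G: "\<And>x y x' y'. of_int x' = of_int (fst (h (1, 0))) * real_of_int x + of_int (fst (h (0, 1))) * of_int y \<Longrightarrow>
       of_int y' = of_int (snd (h (1, 0))) * real_of_int x + of_int (snd (h (0, 1))) * of_int y \<Longrightarrow>
       form_value G (x, y) = form_value F (x', y')"
    by (rule form_value_substitution[of F "of_int (fst (h (1, 0)))" "of_int (snd (h (0, 1)))"
        "of_int (fst (h (0, 1)))" "of_int (snd (h (1, 0)))"]) blast
  obtain a b c where g: "g = Form a b c" by (cases g)
  have "form_value G (x, y) = form_value F (h (x, y))" for x y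
    by (subst module_hom_zscale_expand[OF assms(1)]) (rule G; simp)
  then have "form_value G = form_value (Form (k * a) (k * b) (k * c))"
    by (auto simp: fun_eq_iff val g algebra_simps)
  then have "G = Form (k * a) (k * b) (k * c)"
    by (simp add: form_value_inject)
  then have "discriminant G = k\<^sup>2 * discriminant g"
    by (simp add: g discriminant_def power2_eq_square algebra_simps)
  with d show ?thesis by simp
qed

lemma composed_of_discriminant_ratio:
  assumes "integer_form f" and "integer_form f'" and "discriminant f' \<noteq> 0"
    and comp: "composed_of F f f' m"
  shows "\<exists>q :: rat. discriminant f / discriminant f' = (of_rat q)\<^sup>2"
proof (cases "f = Form 0 0 0")
  case True
  then show ?thesis by (intro exI[of _ 0]) (simp add: discriminant_def)
next
  case False
  then obtain w where w: "form_value f w \<noteq> 0"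
    using form_value_nonzero_exists by blast
  obtain w' where w': "form_value f' w' \<noteq> 0"
    using form_value_nonzero_exists assms(3) by blast
  have hom: "module_hom zscale zscale (\<lambda>x'. m w x')" "module_hom zscale zscale (\<lambda>x. m x w')"
    and val: "form_value F (m x x') = form_value f x * form_value f' x'" for x x'
    using comp unfolding composed_of_def Z_bilinear_def by blast+
  obtain D :: int where D: "discriminant F * (of_int D)\<^sup>2 = (form_value f w)\<^sup>2 * discriminant f'"
    using discriminant_substitution[OF hom(1), of F "form_value f w" f'] val by blast
  obtain D' :: int where D': "discriminant F * (of_int D')\<^sup>2 = (form_value f' w')\<^sup>2 * discriminant f"
    using discriminant_substitution[OF hom(2), of F "form_value f' w'" f] val
    by (metis mult.commute)
  obtain n where n: "form_value f w = of_int n"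
    using integer_form_value_Ints[OF assms(1)] Ints_cases by blast
  obtain n' where n': "form_value f' w' = of_int n'"
    using integer_form_value_Ints[OF assms(2)] Ints_cases by blast
  have nz: "discriminant F \<noteq> 0" "D \<noteq> 0"
    using D w assms(3) by auto
  have "discriminant f' = discriminant F * (of_int D)\<^sup>2 / (of_int n)\<^sup>2"
    "discriminant f = discriminant F * (of_int D')\<^sup>2 / (of_int n')\<^sup>2"
    using D D' w w' by (simp_all add: n n' field_simps)
  \<comment> \<open>The common factor \<open>discriminant F\<close> cancels, so it may be
    irrational.\<close>
  then have "discriminant f / discriminant f' = (of_int (D' * n) / of_int (D * n'))\<^sup>2"
    using nz w w' by (simp add: n n' power_mult_distrib power_divide)
  also have "\<dots> = (of_rat (of_int (D' * n) / of_int (D * n')))\<^sup>2"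
    by (simp add: of_rat_divide of_rat_mult)
  finally show ?thesis by blast
qed

section \<open>Subgroups of the integers and of the integer lattice\<close>

lemma int_subgroup_principal:
  fixes A :: "int set"
  assumes "0 \<in> A" and add: "\<And>x y. x \<in> A \<Longrightarrow> y \<in> A \<Longrightarrow> x + y \<in> A"
    and scale: "\<And>k x. x \<in> A \<Longrightarrow> k * x \<in> A"
  shows "\<exists>g\<in>A. \<forall>x\<in>A. g dvd x"
proof (cases "A = {0}")
  case True
  then show ?thesis by simp
next
  case False
  then obtain x where "x \<in> A" "x \<noteq> 0" using \<open>0 \<in> A\<close> by blast
  then have "\<exists>n::nat. 0 < n \<and> int n \<in> A"
    using scale[of x 1] scale[of x "-1"] by (intro exI[of _ "nat \<bar>x\<bar>"]) (auto simp: abs_if)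
  then obtain n where n: "0 < n" "int n \<in> A" and least: "\<And>k. k < n \<Longrightarrow> \<not> (0 < k \<and> int k \<in> A)"
    using exists_least_iff[of "\<lambda>n. 0 < n \<and> int n \<in> A"] by blast
  \<comment> \<open>Division by the least positive element leaves a remainder that is again in
    \<open>A\<close>, hence zero.\<close>
  have "int n dvd x" if "x \<in> A" for x
  proof -
    have "x mod int n = x + (- (x div int n)) * int n"
      by (simp add: minus_div_mult_eq_mod [symmetric])
    then have "x mod int n \<in> A"
      using add that scale n by metis
    moreover have range: "x mod int n \<ge> 0" "x mod int n < int n"
      using n by simp_all
    ultimately have "\<not> x mod int n > 0"
      using least[of "nat (x mod int n)"] by (simp add: nat_less_iff)
    with range have "x mod int n = 0" by linarith
    then show ?thesis by auto
  qed
  then show ?thesis using n by blast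
qed

text \<open>\<open>h\<close> generates the part of \<open>L\<close> on the first axis,
  \<open>g\<close> generates the projection to the second coordinate, and \<open>k\<close> comes
  from a lift of \<open>g\<close> to \<open>L\<close>. Either generator may be 0, so every rank is
  covered.\<close>

lemma Z2_subspace_hermite_basis:
  assumes L: "Z2.subspace L"
  obtains h k g where "L = range (\<lambda>(s, t). (s * h + t * k, t * g))"
proof -
  have add: "x + y \<in> L" if "x \<in> L" "y \<in> L" for x y
    using L that by (rule Z2.subspace_add)
  have scale: "zscale r x \<in> L" if "x \<in> L" for r x
    using L that by (rule Z2.subspace_scale)
  have zero: "(0, 0) \<in> L"
    using Z2.subspace_0[OF L] by (simp add: zero_prod_def)
  have "\<exists>h\<in>{x. (x, 0) \<in> L}. \<forall>x\<in>{x. (x, 0) \<in> L}. h dvd x"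
  proof (rule int_subgroup_principal)
    show "x + y \<in> {x. (x, 0) \<in> L}" if "x \<in> {x. (x, 0) \<in> L}" "y \<in> {x. (x, 0) \<in> L}" for x y
      using that add[of "(x, 0)" "(y, 0)"] by simp
    show "r * x \<in> {x. (x, 0) \<in> L}" if "x \<in> {x. (x, 0) \<in> L}" for r x
      using that scale[of "(x, 0)" r] by (simp add: zscale_def)
  qed (use zero in simp)
  then obtain h where h: "(h, 0) \<in> L" "\<And>x. (x, 0) \<in> L \<Longrightarrow> h dvd x"
    by auto
  have "\<exists>g\<in>snd ` L. \<forall>y\<in>snd ` L. g dvd y"
  proof (rule int_subgroup_principal)
    show "0 \<in> snd ` L" using zero by force
    show "x + y \<in> snd ` L" if "x \<in> snd ` L" "y \<in> snd ` L" for x y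
      using that add by (metis (no_types, lifting) image_iff snd_add)
    show "r * x \<in> snd ` L" if "x \<in> snd ` L" for r x
      using that scale by (force simp: image_iff zscale_def)
  qed
  then obtain g where g: "g \<in> snd ` L" "\<And>y. y \<in> snd ` L \<Longrightarrow> g dvd y"
    by blast
  then obtain k where k: "(k, g) \<in> L" by force
  have "(x, y) \<in> range (\<lambda>(s, t). (s * h + t * k, t * g))" if xy: "(x, y) \<in> L" for x y
  proof -
    obtain t where t: "y = t * g" using g(2)[of y] xy by (force simp: mult.commute)
    have "(x, y) + zscale (- t) (k, g) \<in> L" using add scale xy k by blast
    then have "(x - t * k, 0) \<in> L" by (simp add: zscale_def t)
    then obtain s where "x - t * k = s * h" using h(2) by (force simp: mult.commute)
    then show ?thesis by (intro image_eqI[of _ _ "(s, t)"]) (auto simp: t)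
  qed
  moreover have "(s * h + t * k, t * g) \<in> L" for s t
    using add[OF scale[OF h(1), of s] scale[OF k, of t]] by (simp add: zscale_def)
  ultimately have "L = range (\<lambda>(s, t). (s * h + t * k, t * g))"
    by (intro subset_antisym subrelI) (blast, clarsimp)
  then show thesis by (rule that)
qed

text \<open>Only the spanning condition is missing for \<open>m\<close>. Expressing its values in a
  basis of the lattice they span, and \<open>F\<close> in the same basis, supplies it.\<close>

lemma composition_law_from_full_rank:
  assumes bil: "Z_bilinear m"
    and val: "\<And>x x'. form_value F (m x x') = form_value f x * form_value f' x'"
    and rank: "fst (m x x') * snd (m y y') \<noteq> fst (m y y') * snd (m x x')"
  shows "\<exists>F m. composed_of F f f' m"
proof -
  let ?S = "{m x x' | x x'. True}"
  obtain h k g where span: "Z2.span ?S = range (\<lambda>(s, t). (s * h + t * k, t * g))"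
    using Z2_subspace_hermite_basis[OF Z2.subspace_span] .
  define T :: "int \<times> int \<Rightarrow> int \<times> int" where "T = (\<lambda>(s, t). (s * h + t * k, t * g))"
  have in_T: "m x x' \<in> range T" for x x'
    using Z2.span_base[of "m x x'" ?S] unfolding span T_def by blast
  have T_hom: "T (u + v) = T u + T v" "T (zscale r u) = zscale r (T u)" for u v r
    by (cases u; cases v; simp add: T_def zscale_def algebra_simps)+
  \<comment> \<open>Otherwise the range of \<open>T\<close> lies on a line and any two values of
    \<open>m\<close> are dependent.\<close>
  have "h \<noteq> 0" "g \<noteq> 0"
    using rank in_T[of x x'] in_T[of y y'] by (auto simp: T_def)
  then have "inj T"
    by (auto simp: inj_def T_def)
  define n where "n x x' = inv T (m x x')" for x x'
  have Tn: "T (n x x') = m x x'" for x x'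
    using in_T by (simp add: n_def f_inv_into_f)
  have n_eqI: "n x x' = u" if "m x x' = T u" for x x' u
    using that \<open>inj T\<close> by (simp add: n_def)
  have "Z_bilinear n"
    using bil unfolding Z_bilinear_def module_hom_zscale_iff
    by (auto intro!: n_eqI simp: T_hom Tn)
  obtain G where G: "\<And>x y x' y'. of_int x' = real_of_int h * of_int x + of_int k * of_int y \<Longrightarrow>
       of_int y' = 0 * real_of_int x + of_int g * of_int y \<Longrightarrow> form_value G (x, y) = form_value F (x', y')"
    by (rule form_value_substitution[of F "real_of_int h" "real_of_int g" "real_of_int k" 0]) blast
  have GT: "form_value G u = form_value F (T u)" for u
    by (cases u) (simp add: T_def G)
  let ?N = "Z2.span {n x x' | x x'. True}"
  have "module_hom zscale zscale T"
    unfolding module_hom_zscale_iff using T_hom by blast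
  \<comment> \<open>The image of \<open>?N\<close> is a subgroup containing all values of
    \<open>m\<close>, hence all of \<open>range T\<close>; injectivity then cancels
    \<open>T\<close>.\<close>
  then have "Z2.subspace (T ` ?N)"
    by (rule module_hom.subspace_image) (rule Z2.subspace_span)
  moreover have "?S \<subseteq> T ` ?N"
  proof
    fix y assume "y \<in> ?S"
    then obtain x x' where "y = T (n x x')" by (auto simp: Tn)
    moreover have "n x x' \<in> ?N" by (rule Z2.span_base) blast
    ultimately show "y \<in> T ` ?N" by blast
  qed
  ultimately have "range T \<subseteq> T ` ?N"
    unfolding T_def span[symmetric] by (rule Z2.span_minimal[rotated])
  then have "?N = UNIV"
    using \<open>inj T\<close> by (auto simp: inj_image_subset_iff)
  with \<open>Z_bilinear n\<close> have "composed_of G f f' n"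
    by (simp add: composed_of_def GT Tn val)
  then show ?thesis by blast
qed

section \<open>Sufficiency: the zero form, then products of norm forms\<close>

lemma composed_of_zero_form:
  defines "m \<equiv> \<lambda>x x' :: int \<times> int. zscale (fst (x :: int \<times> int)) x'"
  shows "composed_of (Form 0 0 0) (Form 0 0 0) f' m"
proof -
  have zero: "form_value (Form 0 0 0) x = 0" for x by (cases x) simp
  have "Z_bilinear m"
    unfolding Z_bilinear_def module_hom_zscale_iff m_def by (auto simp: zscale_def algebra_simps)
  moreover have "u = m (1, 0) u" for u
    by (simp add: m_def zscale_def)
  then have "u \<in> Z2.span {m x x' | x x'. True}" for u
    by (intro Z2.span_base) blast
  then have "Z2.span {m x x' | x x'. True} = UNIV"
    by blast
  ultimately show ?thesis
    by (simp add: composed_of_def zero)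
qed

text \<open>This is the Gram determinant identity for the pair \<open>w\<close>, \<open>x\<close>:
  the first square is that of the polar form f(w+x) - f(w) - f(x), the last that of the determinant
  of the pair.\<close>

lemma complete_square_at:
  fixes a b c w\<^sub>1 w\<^sub>2 x\<^sub>1 x\<^sub>2 :: "'a :: comm_ring_1"
  shows "4 * (a * w\<^sub>1\<^sup>2 + b * w\<^sub>1 * w\<^sub>2 + c * w\<^sub>2\<^sup>2) * (a * x\<^sub>1\<^sup>2 + b * x\<^sub>1 * x\<^sub>2 + c * x\<^sub>2\<^sup>2)
    = (2 * a * w\<^sub>1 * x\<^sub>1 + b * (w\<^sub>1 * x\<^sub>2 + w\<^sub>2 * x\<^sub>1) + 2 * c * w\<^sub>2 * x\<^sub>2)\<^sup>2
      - (b\<^sup>2 - 4 * a * c) * (w\<^sub>1 * x\<^sub>2 - w\<^sub>2 * x\<^sub>1)\<^sup>2"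
  by (simp add: power2_eq_square algebra_simps)

lemma integer_form_norm_representation:
  assumes "integer_form f" and w: "form_value f w \<noteq> 0"
  obtains U V :: "int \<times> int \<Rightarrow> int" and v where
    "\<And>x y. U (x + y) = U x + U y" "\<And>r x. U (zscale r x) = r * U x"
    "\<And>x y. V (x + y) = V x + V y" "\<And>r x. V (zscale r x) = r * V x"
    "\<And>x. 4 * form_value f w * form_value f x = (of_int (U x))\<^sup>2 - discriminant f * (of_int (V x))\<^sup>2"
    "U w \<noteq> 0" "V w = 0" "V v \<noteq> 0"
proof -
  obtain a b c where f: "f = Form (real_of_int a) (of_int b) (of_int c)"
    using assms(1) by (rule integer_formE)
  obtain w\<^sub>1 w\<^sub>2 where w_eq: "w = (w\<^sub>1, w\<^sub>2)" by (cases w)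
  define U where "U x = 2 * a * w\<^sub>1 * fst x + b * (w\<^sub>1 * snd x + w\<^sub>2 * fst x) + 2 * c * w\<^sub>2 * snd x" for x
  define V where "V x = w\<^sub>1 * snd x - w\<^sub>2 * fst x" for x
  show thesis
  \<comment> \<open>Rotating \<open>w\<close> by a right angle gives \<open>V\<close> the value
    \<open>w\<^sub>1\<^sup>2 + w\<^sub>2\<^sup>2\<close>.\<close>
  proof (rule that[of U V "(- w\<^sub>2, w\<^sub>1)"])
    show norm: "4 * form_value f w * form_value f x =
      (of_int (U x))\<^sup>2 - discriminant f * (of_int (V x))\<^sup>2" for x
      by (cases x) (simp add: f w_eq U_def V_def discriminant_def
          complete_square_at[symmetric] del: distrib_left_numeral distrib_right_numeral)
    show "V w = 0" by (simp add: V_def w_eq)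
    with norm[of w] w show "U w \<noteq> 0" by auto
    have "w\<^sub>1 \<noteq> 0 \<or> w\<^sub>2 \<noteq> 0" using w by (auto simp: f w_eq)
    then show "V (- w\<^sub>2, w\<^sub>1) \<noteq> 0"
      by (simp add: V_def)
  qed (simp_all add: U_def V_def zscale_def algebra_simps)
qed

lemma composition_law_from_square_ratio:
  assumes "integer_form f" and "integer_form f'" and "discriminant f' \<noteq> 0"
    and "discriminant f / discriminant f' = (of_rat q)\<^sup>2"
  shows "\<exists>F m. composed_of F f f' m"
proof (cases "f = Form 0 0 0")
  case True
  \<comment> \<open>The zero form has no vector \<open>w\<close> at which to complete the
    square.\<close>
  then show ?thesis using composed_of_zero_form by blast
next
  case False
  obtain p r where "quotient_of q = (p, r)" by force
  then have r: "r > 0" and q: "q = of_int p / of_int r"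
    by (auto dest: quotient_of_denom_pos quotient_of_div)
  have d: "discriminant f * (of_int r)\<^sup>2 = discriminant f' * (of_int p)\<^sup>2"
    using assms(3,4) r by (simp add: q of_rat_divide field_simps)
  obtain e where e: "discriminant f' = of_int e"
  proof -
    from assms(2) obtain a b c where "f' = Form (real_of_int a) (of_int b) (of_int c)"
      by (rule integer_formE)
    then show ?thesis by (intro that[of "b\<^sup>2 - 4 * a * c"]) (simp add: discriminant_def)
  qed
  obtain w where w: "form_value f w \<noteq> 0"
    using form_value_nonzero_exists False by blast
  obtain w' where w': "form_value f' w' \<noteq> 0"
    using form_value_nonzero_exists assms(3) by blast
  obtain U V v where UV:
    "\<And>x y. U (x + y) = U x + U y" "\<And>r x. U (zscale r x) = r * U x"
    "\<And>x y. V (x + y) = V x + V y" "\<And>r x. V (zscale r x) = r * V x"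
    and norm: "\<And>x. 4 * form_value f w * form_value f x = (of_int (U x))\<^sup>2 - discriminant f * (of_int (V x))\<^sup>2"
    and UVw: "U w \<noteq> 0" "V w = 0" "V v \<noteq> 0"
    by (rule integer_form_norm_representation[OF assms(1) w]) blast
  obtain U' V' v' where UV':
    "\<And>x y. U' (x + y) = U' x + U' y" "\<And>r x. U' (zscale r x) = r * U' x"
    "\<And>x y. V' (x + y) = V' x + V' y" "\<And>r x. V' (zscale r x) = r * V' x"
    and norm': "\<And>x. 4 * form_value f' w' * form_value f' x = (of_int (U' x))\<^sup>2 - discriminant f' * (of_int (V' x))\<^sup>2"
    and UVw': "U' w' \<noteq> 0" "V' w' = 0" "V' v' \<noteq> 0"
    by (rule integer_form_norm_representation[OF assms(2) w']) blast
  \<comment> \<open>These are the coordinates of (r U + p V t)(U' + V' t) with t^2 =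
    \<open>e\<close>. By \<open>d\<close>, the norm of the first factor is \<open>r\<^sup>2\<close>
    times that of U + V sqrt(d(f)).\<close>
  define m where "m x x' =
    (r * U x * U' x' + e * p * V x * V' x', r * U x * V' x' + p * V x * U' x')" for x x'
  \<comment> \<open>\<open>K\<close> collects \<open>r\<^sup>2\<close> and the factors 4 f(w) and 4
    f'(w') from completing the squares; \<open>F\<close> is the norm form divided by
    \<open>K\<close>.\<close>
  define K where "K = 16 * (of_int r)\<^sup>2 * form_value f w * form_value f' w'"
  define F where "F = Form (1 / K) 0 (- of_int e / K)"
  have K: "K \<noteq> 0" using r w w' by (simp add: K_def)
  show ?thesis
  proof (rule composition_law_from_full_rank)
    show "Z_bilinear m"
      unfolding Z_bilinear_def module_hom_zscale_iff
      by (simp add: m_def UV UV' zscale_Pair algebra_simps del: split_paired_All)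
    show "form_value F (m x x') = form_value f x * form_value f' x'" for x x'
    proof -
      have "K * form_value F (m x x') = (of_int (fst (m x x')))\<^sup>2 - of_int e * (of_int (snd (m x x')))\<^sup>2"
        using K by (simp add: F_def m_def field_simps)
      \<comment> \<open>Multiplicativity of the norm (Brahmagupta's identity).\<close>
      also have "\<dots> = ((of_int r * of_int (U x))\<^sup>2 - of_int e * (of_int p * of_int (V x))\<^sup>2)
          * ((of_int (U' x'))\<^sup>2 - of_int e * (of_int (V' x'))\<^sup>2)"
        by (simp add: m_def power2_eq_square algebra_simps)
      also have "of_int e * (of_int p * of_int (V x))\<^sup>2 = discriminant f * (of_int r)\<^sup>2 * (of_int (V x))\<^sup>2"
        by (simp add: d e power_mult_distrib)
      also have "(of_int r * of_int (U x))\<^sup>2 - \<dots> = (of_int r)\<^sup>2 * (4 * form_value f w * form_value f x)"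
        by (simp only: norm) (simp add: power2_eq_square algebra_simps)
      also have "(of_int (U' x'))\<^sup>2 - of_int e * (of_int (V' x'))\<^sup>2 = 4 * form_value f' w' * form_value f' x'"
        by (simp only: norm' e)
      also have "(of_int r)\<^sup>2 * (4 * form_value f w * form_value f x) * (4 * form_value f' w' * form_value f' x')
          = K * (form_value f x * form_value f' x')"
        by (simp add: K_def)
      finally show ?thesis using K by simp
    qed
    \<comment> \<open>Since \<open>V w\<close> and \<open>V' w'\<close> vanish, the right side is 0
      and the left side is \<open>r\<^sup>2 * (U w)\<^sup>2 * U' w' * V' v'\<close>.\<close>
    show "fst (m w w') * snd (m w v') \<noteq> fst (m w v') * snd (m w w')"
      using r UVw UVw' by (simp add: m_def)
  qed
qed

theorem theoremB:
  fixes f f' :: quadratic_form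
  assumes "integer_form f" and "integer_form f'" and "discriminant f' \<noteq> 0"
  shows "(\<exists>(F :: quadratic_form) (m :: int \<times> int \<Rightarrow> int \<times> int \<Rightarrow> int \<times> int). composed_of F f f' m)
    \<longleftrightarrow> (\<exists>q :: rat. discriminant f / discriminant f' = (of_rat q)\<^sup>2)"
  using composed_of_discriminant_ratio[OF assms] composition_law_from_square_ratio[OF assms]
  by blast

end
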